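(* Let $n$ be a non-negative integer and let $q,a,b,c$ be non-zero complex numbers such that no denominator on either side below vanishes. Then $${}_3\phi_2\left[\begin{matrix} a,\ b,\ q^{-n}\\ c,\ abq^{-n+1}/c\end{matrix};q,q\right]=\frac{(c/a,\,c/b;q)_n}{(c,\,c/(ab);q)_n} .$$
   Context: For complex $a,q$ and a non-negative integer $n$, $(a;q)_n:=\prod_{k=0}^{n-1}(1-aq^k)$, with $(a;q)_0=1$, and $(a_1,\ldots,a_k;q)_n:=\prod_{i=1}^k (a_i;q)_n$. The unilateral basic hypergeometric series is $${}_{r+1}\phi_r\left[\begin{matrix} a_0,\ldots,a_r\\ b_1,\ldots,b_r\end{matrix};q,z\right]:=\sum_{j=0}^{\infty}\frac{(a_0,\ldots,a_r;q)_j}{(q,b_1,\ldots,b_r;q)_j}z^j .$$ When one numerator parameter is $q^{-n}$ the series terminates and is read as the finite sum over $0\le j\le n$ (so no convergence condition on $z$ is needed). *)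

theory Defs
  imports Complex_Main
begin

definition qpoch :: "complex \<Rightarrow> complex \<Rightarrow> nat \<Rightarrow> complex" where
  "qpoch a q n = (\<Prod>k<n. 1 - a * q ^ k)"

definition qpochs :: "complex list \<Rightarrow> complex \<Rightarrow> nat \<Rightarrow> complex" where
  "qpochs as q n = (\<Prod>a\<leftarrow>as. qpoch a q n)"

text \<open>
  The series with numerator parameters \<open>as\<close> and denominator parameters \<open>bs\<close>. It is the
  usual series only when \<open>length as = length bs + 1\<close>; for other lengths the standard
  definition carries an additional factor, which is omitted here.
\<close>

definition qhyp_term :: "complex list \<Rightarrow> complex list \<Rightarrow> complex \<Rightarrow> complex \<Rightarrow> nat \<Rightarrow> complex" where
  "qhyp_term as bs q z j = qpochs as q j / qpochs (q # bs) q j * z ^ j"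

definition qhyp :: "complex list \<Rightarrow> complex list \<Rightarrow> complex \<Rightarrow> complex \<Rightarrow> complex" where
  "qhyp as bs q z = (\<Sum>j. qhyp_term as bs q z j)"

text \<open>
  If \<open>q\<^sup>-\<^sup>n\<close> is a numerator parameter, all terms with \<open>j > n\<close> are zero (also those whose
  denominator vanishes, since \<open>x / 0 = 0\<close>), so the infinite series is the finite sum over
  \<open>0 \<le> j \<le> n\<close> for every \<open>z\<close>.
\<close>

lemma qhyp_term_eq_0:
  assumes "q \<noteq> 0" "q powi (- int n) \<in> set as" "j > n"
  shows "qhyp_term as bs q z j = 0"
proof -
  have "q powi (- int n) * q ^ n = 1"
    using assms(1) by (simp add: power_int_minus)
  hence "qpoch (q powi (- int n)) q j = 0"
    unfolding qpoch_def using assms(3) by (intro prod_zero) auto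
  hence "0 \<in> set (map (\<lambda>a. qpoch a q j) as)"
    using assms(2) by force
  hence "qpochs as q j = 0"
    unfolding qpochs_def by (simp only: prod_list_zero_iff)
  thus ?thesis by (simp add: qhyp_term_def)
qed

lemma qhyp_terminating:
  assumes "q \<noteq> 0" "q powi (- int n) \<in> set as"
  shows "qhyp_term as bs q z sums (\<Sum>j\<le>n. qhyp_term as bs q z j)"
    and "qhyp as bs q z = (\<Sum>j\<le>n. qhyp_term as bs q z j)"
proof -
  show "qhyp_term as bs q z sums (\<Sum>j\<le>n. qhyp_term as bs q z j)"
    by (rule sums_finite) (use qhyp_term_eq_0[OF assms] in auto)
  thus "qhyp as bs q z = (\<Sum>j\<le>n. qhyp_term as bs q z j)"
    unfolding qhyp_def by (rule sums_unique[symmetric])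
qed

end

theory Submission imports Defs begin

text \<open>
  This is the \<open>q\<close>-analogue of the Pfaff--Saalschuetz sum. Put \<open>d = c / (a b)\<close>. The two
  parameters \<open>q\<^sup>-\<^sup>n\<close> and \<open>q\<^sup>1\<^sup>-\<^sup>n / d\<close> that depend on \<open>n\<close> give products that run backwards
  through \<open>(q;q)\<^sub>n\<close> and \<open>(d;q)\<^sub>n\<close>; reversing them (lemma \<open>qpoch_reverse\<close>) turns the series,
  up to the factor \<open>(q;q)\<^sub>n / (d;q)\<^sub>n\<close>, into the convolution
  \<open>\<Sum>j\<le>n. A\<^sub>j D\<^sub>n\<^sub>-\<^sub>j\<close> with
  \<open>A\<^sub>j = (a,b;q)\<^sub>j d\<^sup>j / (q,c;q)\<^sub>j\<close> and \<open>D\<^sub>k = (d;q)\<^sub>k / (q;q)\<^sub>k\<close>.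
  Neither sequence depends on \<open>n\<close>, so the convolutions can be evaluated by induction on \<open>n\<close>.
  (Their generating function is the product in Heine's \<open>q\<close>-Euler transformation.)

  The claimed value \<open>(a d, b d;q)\<^sub>n / (q,c;q)\<^sub>n\<close> of the convolution grows from \<open>n\<close> to \<open>n + 1\<close> by the factor
  \<open>(1 - a d q\<^sup>n) (1 - b d q\<^sup>n) / ((1 - q\<^sup>n\<^sup>+\<^sup>1) (1 - c q\<^sup>n))\<close>. The case \<open>n = 1\<close> of the theorem,
  with denominators cleared and its parameters \<open>a\<close>, \<open>b\<close>, \<open>d\<close> shifted to
  \<open>a q\<^sup>j\<close>, \<open>b q\<^sup>j\<close>, \<open>d q\<^sup>n\<^sup>-\<^sup>j\<close>, splits the numerator of this factor
  for every \<open>j\<close> into a part that advances \<open>D\<^sub>n\<^sub>-\<^sub>j\<close> and a part that advances \<open>A\<^sub>j\<close>. Collecting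
  the coefficient of each \<open>A\<^sub>j D\<^sub>n\<^sub>+\<^sub>1\<^sub>-\<^sub>j\<close>, the dependence on \<open>j\<close> cancels and the denominator
  remains; this is lemma \<open>qsaal_convolution_step\<close>.
\<close>

lemma qpoch_0 [simp]: "qpoch a q 0 = 1"
  by (simp add: qpoch_def)

lemma qpoch_Suc [simp]: "qpoch a q (Suc n) = qpoch a q n * (1 - a * q ^ n)"
  by (simp add: qpoch_def)

lemma qpoch_nonzero_mono:
  assumes "qpoch a q n \<noteq> 0" "j \<le> n"
  shows "qpoch a q j \<noteq> 0"
  using assms by (auto simp: qpoch_def)

text \<open>
  Each factor of \<open>(q\<^sup>1\<^sup>-\<^sup>n / d; q)\<^sub>j\<close> satisfies
  \<open>1 - q\<^sup>1\<^sup>-\<^sup>n\<^sup>+\<^sup>k / d = (- 1 / d) q\<^sup>1\<^sup>-\<^sup>n\<^sup>+\<^sup>k (1 - d q\<^sup>n\<^sup>-\<^sup>1\<^sup>-\<^sup>k)\<close>, so up to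
  the first two of these three factors the product consists of the last \<open>j\<close> factors of
  \<open>(d; q)\<^sub>n\<close>. The power of \<open>q\<close> is left as a product, since it
  cancels between the instances \<open>d\<close> and \<open>q\<close>.
\<close>

lemma qpoch_reverse:
  fixes d q :: complex
  assumes "q \<noteq> 0" "d \<noteq> 0" "j \<le> n"
  shows "qpoch (q powi (1 - int n) / d) q j * qpoch d q (n - j)
       = (- 1 / d) ^ j * (\<Prod>k<j. q powi (1 - int n + int k)) * qpoch d q n"
  using assms(3)
proof (induction j)
  case 0
  show ?case by simp
next
  case (Suc j)
  obtain m where m: "n - j = Suc m" "n = Suc (m + j)"
    using Suc.prems by (metis Suc_diff_Suc Suc_le_eq add_Suc le_add_diff_inverse2 less_imp_le)
  define r where "r = q powi (1 - int n + int j)"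
  have r: "q powi (1 - int n) * q ^ j = r"
    using assms(1) by (simp add: r_def power_int_add)
  have rm: "r * q ^ m = 1"
    using assms(1) m(2) by (simp add: r_def power_int_minus)
  have factor: "1 - r / d = (- 1 / d) * r * (1 - d * q ^ m)"
    using rm assms(2) by (simp add: field_simps)
  have "qpoch (q powi (1 - int n) / d) q (Suc j) * qpoch d q (n - Suc j)
      = qpoch (q powi (1 - int n) / d) q j * (1 - r / d) * qpoch d q m"
    using m by (simp add: r[symmetric])
  also have "\<dots> = (- 1 / d) * r * (qpoch (q powi (1 - int n) / d) q j * qpoch d q (n - j))"
    unfolding factor m(1) by simp
  also have "\<dots> = (- 1 / d) ^ Suc j * (\<Prod>k<Suc j. q powi (1 - int n + int k)) * qpoch d q n"
    using Suc by (simp add: r_def)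
  finally show ?case .
qed

text \<open>
  The powers of \<open>q\<close> from the two reversals cancel: the quotient of the two products whose
  parameters depend on \<open>n\<close> becomes a quotient of shifted factorials of length \<open>n - j\<close>, which is what makes
  the sum a convolution.
\<close>

lemma qpoch_reverse_ratio:
  fixes d q :: complex
  assumes "q \<noteq> 0" "d \<noteq> 0" "j \<le> n" "qpoch q q n \<noteq> 0" "qpoch d q n \<noteq> 0"
  shows "qpoch (q powi (- int n)) q j / qpoch (q powi (1 - int n) / d) q j * q ^ j
       = qpoch q q n / qpoch d q n * (d ^ j * (qpoch d q (n - j) / qpoch q q (n - j)))"
proof -
  define P where "P = (\<Prod>k<j. q powi (1 - int n + int k))"
  have "q powi (1 - int n) / q = q powi (- int n)"
    using assms(1) by (simp add: power_int_diff power_int_minus field_simps)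
  hence num: "qpoch (q powi (- int n)) q j * qpoch q q (n - j) = (- 1 / q) ^ j * P * qpoch q q n"
    using qpoch_reverse[OF assms(1) assms(1) assms(3)] by (simp add: P_def)
  have den: "qpoch (q powi (1 - int n) / d) q j * qpoch d q (n - j) = (- 1 / d) ^ j * P * qpoch d q n"
    using qpoch_reverse[OF assms(1-3)] by (simp add: P_def)
  have nz: "qpoch q q (n - j) \<noteq> 0" "qpoch d q (n - j) \<noteq> 0" "P \<noteq> 0"
    using assms qpoch_nonzero_mono by (auto simp: P_def)
  have num': "qpoch (q powi (- int n)) q j = (- 1 / q) ^ j * P * qpoch q q n / qpoch q q (n - j)"
    using num nz by (simp add: field_simps)
  have den': "qpoch (q powi (1 - int n) / d) q j
            = (- 1 / d) ^ j * P * qpoch d q n / qpoch d q (n - j)"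
    using den nz by (simp add: field_simps)
  have sign: "(- 1 / x) ^ j = (- 1) ^ j / x ^ j" for x :: complex
    by (rule power_divide)
  show ?thesis
    unfolding num' den' sign using nz assms by (simp add: field_simps)
qed

text \<open>
  Only the first-order recurrences of \<open>A\<close> and \<open>D\<close> matter. In the proof, the sum for \<open>n\<close> is
  split into two sums over \<open>j \<le> n\<close>, and both extend to \<open>j \<le> n + 1\<close> because the new boundary
  terms carry the factor \<open>1 - q\<^sup>0\<close>.
\<close>

lemma qsaal_convolution_step:
  fixes A D :: "nat \<Rightarrow> complex" and a b d q :: complex
  assumes A: "\<And>j. j \<le> n \<Longrightarrow>
      A (Suc j) * ((1 - q ^ Suc j) * (1 - a * b * d * q ^ j)) = A j * ((1 - a * q ^ j) * (1 - b * q ^ j) * d)"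
    and D: "\<And>k. k \<le> n \<Longrightarrow> D (Suc k) * (1 - q ^ Suc k) = D k * (1 - d * q ^ k)"
  shows "(1 - q ^ Suc n) * (1 - a * b * d * q ^ n) * (\<Sum>j\<le>Suc n. A j * D (Suc n - j))
       = (1 - a * d * q ^ n) * (1 - b * d * q ^ n) * (\<Sum>j\<le>n. A j * D (n - j))"
proof -
  define e where "e = a * b * d"
  define X where "X j = A j * D (Suc n - j) * ((1 - q ^ (Suc n - j)) * (1 - e * q ^ (n + j)))" for j
  define Y where "Y j = A j * D (Suc n - j) * ((1 - q ^ j) * (q ^ (Suc n - j) - e * q ^ n))" for j
  have split: "(1 - a * d * q ^ n) * (1 - b * d * q ^ n) * (A j * D (n - j)) = X j + Y (Suc j)"
    if j: "j \<le> n" for j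
  proof -
    obtain k where k: "n = j + k" using le_Suc_ex[OF j] by (elim exE)
    have "X j = A j * (D (Suc k) * (1 - q ^ Suc k)) * (1 - e * q ^ (n + j))"
      by (simp add: X_def k Suc_diff_le)
    hence X: "X j = A j * D k * ((1 - d * q ^ k) * (1 - e * q ^ (n + j)))"
      using D[of k] k by (simp only: le_add2 mult.assoc)
    have "Y (Suc j) = A (Suc j) * ((1 - q ^ Suc j) * (1 - e * q ^ j)) * D k * q ^ k"
      by (simp add: Y_def k power_add algebra_simps)
    hence Y: "Y (Suc j) = A j * D k * ((1 - a * q ^ j) * (1 - b * q ^ j) * d * q ^ k)"
      unfolding A[OF j, folded e_def] by simp
    (* the one-step case of the summation, in the parameters a q^j, b q^j, d q^k *)
    have shift: "(1 - a * d * q ^ n) * (1 - b * d * q ^ n)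
        = (1 - d * q ^ k) * (1 - e * q ^ (n + j)) + (1 - a * q ^ j) * (1 - b * q ^ j) * d * q ^ k"
      by (simp add: k e_def power_add algebra_simps)
    have "D (n - j) = D k"
      by (simp add: k)
    thus ?thesis
      unfolding X Y shift by (simp only: distrib_left mult.commute)
  qed
  have merge: "X j + Y j = (1 - q ^ Suc n) * (1 - e * q ^ n) * (A j * D (Suc n - j))"
    if j: "j \<le> Suc n" for j
  proof -
    obtain k where k: "Suc n = j + k" using le_Suc_ex[OF j] by (elim exE)
    have *: "q ^ j * q ^ k = q * q ^ n"
      by (metis k power_Suc power_add)
    have "(1 - q ^ k) * (1 - e * q ^ (n + j)) + (1 - q ^ j) * (q ^ k - e * q ^ n)
        = 1 - q ^ j * q ^ k - e * q ^ n + e * q ^ n * (q ^ j * q ^ k)"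
      by (simp add: power_add algebra_simps)
    also have "\<dots> = (1 - q ^ Suc n) * (1 - e * q ^ n)"
      unfolding * by (simp add: algebra_simps)
    finally show ?thesis
      by (simp add: X_def Y_def k mult.commute flip: distrib_left)
  qed
  have "(1 - a * d * q ^ n) * (1 - b * d * q ^ n) * (\<Sum>j\<le>n. A j * D (n - j))
      = (\<Sum>j\<le>n. X j) + (\<Sum>j\<le>n. Y (Suc j))"
    unfolding sum_distrib_left sum.distrib[symmetric] by (intro sum.cong refl split) simp
  also have "(\<Sum>j\<le>n. X j) = (\<Sum>j\<le>Suc n. X j)"
    by (simp add: X_def)
  also have "(\<Sum>j\<le>n. Y (Suc j)) = (\<Sum>j\<le>Suc n. Y j)"
    by (subst sum.atMost_Suc_shift) (simp add: Y_def)
  also have "(\<Sum>j\<le>Suc n. X j) + (\<Sum>j\<le>Suc n. Y j)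
      = (1 - q ^ Suc n) * (1 - e * q ^ n) * (\<Sum>j\<le>Suc n. A j * D (Suc n - j))"
    unfolding sum_distrib_left sum.distrib[symmetric] by (intro sum.cong refl merge) simp
  finally show ?thesis by (simp add: e_def)
qed

lemma qsaal_convolution:
  fixes a b d q :: complex
  assumes "qpoch q q n \<noteq> 0" "qpoch (a * b * d) q n \<noteq> 0"
  shows "(\<Sum>j\<le>n. qpoch a q j * qpoch b q j / (qpoch q q j * qpoch (a * b * d) q j) * d ^ j
             * (qpoch d q (n - j) / qpoch q q (n - j)))
       = qpoch (a * d) q n * qpoch (b * d) q n / (qpoch q q n * qpoch (a * b * d) q n)"
  using assms
proof (induction n)
  case 0
  show ?case by simp
next
  case (Suc n)
  define A where "A j = qpoch a q j * qpoch b q j / (qpoch q q j * qpoch (a * b * d) q j) * d ^ j" for j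
  define D where "D k = qpoch d q k / qpoch q q k" for k
  have nz: "qpoch q q (Suc j) \<noteq> 0" "qpoch (a * b * d) q (Suc j) \<noteq> 0" if "j \<le> n" for j
    using Suc.prems that qpoch_nonzero_mono by (meson Suc_le_mono)+
  have A: "A (Suc j) * ((1 - q ^ Suc j) * (1 - a * b * d * q ^ j))
         = A j * ((1 - a * q ^ j) * (1 - b * q ^ j) * d)" if "j \<le> n" for j
    using nz[OF that] by (simp add: A_def)
  have D: "D (Suc k) * (1 - q ^ Suc k) = D k * (1 - d * q ^ k)" if "k \<le> n" for k
    using nz[OF that] by (simp add: D_def)
  have IH: "(\<Sum>j\<le>n. A j * D (n - j))
      = qpoch (a * d) q n * qpoch (b * d) q n / (qpoch q q n * qpoch (a * b * d) q n)"
    using Suc.IH Suc.prems by (simp add: A_def D_def)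
  define S where "S = (\<Sum>j\<le>Suc n. A j * D (Suc n - j))"
  have "(1 - q ^ Suc n) * (1 - a * b * d * q ^ n) * S
      = (1 - a * d * q ^ n) * (1 - b * d * q ^ n)
        * (qpoch (a * d) q n * qpoch (b * d) q n / (qpoch q q n * qpoch (a * b * d) q n))"
    unfolding S_def IH[symmetric] by (rule qsaal_convolution_step[OF A D])
  moreover have "(1 - q ^ Suc n) * (1 - a * b * d * q ^ n) \<noteq> 0"
    using Suc.prems by simp
  ultimately have "S = (1 - a * d * q ^ n) * (1 - b * d * q ^ n)
        * (qpoch (a * d) q n * qpoch (b * d) q n / (qpoch q q n * qpoch (a * b * d) q n))
        / ((1 - q ^ Suc n) * (1 - a * b * d * q ^ n))"
    by (metis nonzero_mult_div_cancel_left)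
  also have "\<dots> = qpoch (a * d) q (Suc n) * qpoch (b * d) q (Suc n)
        / (qpoch q q (Suc n) * qpoch (a * b * d) q (Suc n))"
    by (simp add: ac_simps)
  finally show ?case by (simp only: S_def A_def D_def)
qed

theorem theorem1p3:
  fixes n :: nat and q a b c :: complex
  assumes "q \<noteq> 0" and "a \<noteq> 0" and "b \<noteq> 0" and "c \<noteq> 0"
    and "\<And>j. j \<le> n \<Longrightarrow> qpochs [q, c, a * b * q powi (- int n + 1) / c] q j \<noteq> 0"
    and "qpochs [c, c / (a * b)] q n \<noteq> 0"
  shows "qhyp [a, b, q powi (- int n)] [c, a * b * q powi (- int n + 1) / c] q q
       = qpochs [c / a, c / b] q n / qpochs [c, c / (a * b)] q n"
proof -
  define d where "d = c / (a * b)"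
  have d: "d \<noteq> 0" "a * b * d = c" "a * d = c / b" "b * d = c / a"
    using assms(2-4) by (simp_all add: d_def)
  have param: "a * b * q powi (- int n + 1) / c = q powi (1 - int n) / d"
    unfolding d_def using assms(2-4) by (simp add: add.commute[of _ 1] mult.commute)
  have nz: "qpoch q q n \<noteq> 0" "qpoch c q n \<noteq> 0" "qpoch d q n \<noteq> 0"
    using assms(5)[of n] assms(6) by (auto simp: qpochs_def d_def)
  have "qhyp [a, b, q powi (- int n)] [c, q powi (1 - int n) / d] q q
      = (\<Sum>j\<le>n. qhyp_term [a, b, q powi (- int n)] [c, q powi (1 - int n) / d] q q j)"
    using assms(1) by (intro qhyp_terminating) auto
  also have "\<dots> = (\<Sum>j\<le>n. qpoch q q n / qpoch d q n *
      (qpoch a q j * qpoch b q j / (qpoch q q j * qpoch c q j) * d ^ j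
        * (qpoch d q (n - j) / qpoch q q (n - j))))"
  proof (intro sum.cong refl)
    fix j assume "j \<in> {..n}"
    hence j: "j \<le> n" by simp
    have "qhyp_term [a, b, q powi (- int n)] [c, q powi (1 - int n) / d] q q j
        = qpoch a q j * qpoch b q j / (qpoch q q j * qpoch c q j)
          * (qpoch (q powi (- int n)) q j / qpoch (q powi (1 - int n) / d) q j * q ^ j)"
      by (simp add: qhyp_term_def qpochs_def mult.assoc)
    also note qpoch_reverse_ratio[OF assms(1) d(1) j nz(1,3)]
    finally show "qhyp_term [a, b, q powi (- int n)] [c, q powi (1 - int n) / d] q q j
        = qpoch q q n / qpoch d q n *
          (qpoch a q j * qpoch b q j / (qpoch q q j * qpoch c q j) * d ^ j
            * (qpoch d q (n - j) / qpoch q q (n - j)))"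
      by (simp only: mult.assoc mult.left_commute)
  qed
  also have "\<dots> = qpoch q q n / qpoch d q n
      * (qpoch (c / b) q n * qpoch (c / a) q n / (qpoch q q n * qpoch c q n))"
    unfolding sum_distrib_left[symmetric]
    using qsaal_convolution[of q n a b d] nz d by simp
  also have "\<dots> = qpochs [c / a, c / b] q n / qpochs [c, c / (a * b)] q n"
    using nz by (simp add: qpochs_def d_def[symmetric] mult.commute)
  finally show ?thesis unfolding param .
qed

end
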